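(* Let $P$ be a poset with inconsistent pairs (PIP), with crossing complex $\Delta_P$ and associated $\mathrm{CAT}(0)$ cubical complex $\square_P$. For every $r$, $\Delta_P$ is $r$-colourable if and only if $\square_P$ is $r$-colourable. Hence $\Delta_P$ is balanced if and only if $\square_P$ is balanced.
   Context: A poset with inconsistent pairs (PIP) is a triple $(P,\le,\nleftrightarrow)$ where $(P,\le)$ is a finite poset and $\nleftrightarrow$ is an irreflexive symmetric relation on $P$ such that $a \nleftrightarrow b$, $a \le a'$, $b \le b'$ imply $a' \nleftrightarrow b'$. A subset is consistent if it contains no pair $a \nleftrightarrow b$. A downset is a subset closed under going down in $\le$; $\max I$ is the set of maximal elements of $I$. The cubical complex $\square_P$ has as vertices the consistent downsets of $P$, and has a face $C(I,M) := \{\, I \setminus N : N \subseteq M \,\}$ (a set of $2^{|M|}$ vertices, of dimension $|M|$) for each pair $(I,M)$ with $I$ a consistent downset and $M \subseteq \max I$; its dimension is the maximum dimension of a face. It is a $\mathrm{CAT}(0)$ cubical complex. The crossing complex $\Delta_P$ is the simplicial complex with vertex set $P$ whose faces are the consistent antichains of $P$; a face $A$ has dimension $|A|-1$. An $r$-colouring of a simplicial complex $\Delta$ is a map $\kappa_s : V(\Delta) \to \{1,\dots,r\}$ such that any two vertices joined by an edge have different images. $\Delta$ is $r$-colourable if an $r$-colouring exists; a $(d-1)$-dimensional simplicial complex is balanced if it is $d$-colourable. An $r$-colouring of a cubical complex $\square$ is a map $\kappa_c : V(\square) \to V([0,1]^r) = \{0,1\}^r$ such that the restriction of $\kappa_c$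 to (the vertex set of) any face of $\square$ is a bijection onto (the vertex set of) a face of the cube $[0,1]^r$. $\square$ is $r$-colourable if an $r$-colouring exists; a $d$-dimensional cubical complex is balanced if it is $d$-colourable. *)

theory Defs
  imports "HOL-Library.FuncSet"
begin

section \<open>Posets with inconsistent pairs\<close>

text \<open>
  The order is \<open>le\<close> (\<open>(a, b) \<in> le\<close> means \<open>a \<le> b\<close>), the inconsistency relation is \<open>inc\<close>.
  Both are contained in \<open>P \<times> P\<close>; for \<open>le\<close> this is part of \<open>partial_order_on\<close>.
\<close>

locale pip =
  fixes P :: "'a set" and le :: "'a rel" and inc :: "'a rel"
  assumes finite_carrier: "finite P"
    and partial_order: "partial_order_on P le"
    and inc_subset: "inc \<subseteq> P \<times> P"
    and inc_irrefl: "irrefl inc"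
    and inc_sym: "sym inc"
    and inc_inherit: "\<lbrakk>(a, b) \<in> inc; (a, a') \<in> le; (b, b') \<in> le\<rbrakk> \<Longrightarrow> (a', b') \<in> inc"

definition consistent :: "'a rel \<Rightarrow> 'a set \<Rightarrow> bool" where
  "consistent inc A \<longleftrightarrow> (\<forall>a\<in>A. \<forall>b\<in>A. (a, b) \<notin> inc)"

definition downset :: "'a set \<Rightarrow> 'a rel \<Rightarrow> 'a set \<Rightarrow> bool" where
  "downset P le I \<longleftrightarrow> I \<subseteq> P \<and> (\<forall>a b. b \<in> I \<and> (a, b) \<in> le \<longrightarrow> a \<in> I)"

definition antichain :: "'a rel \<Rightarrow> 'a set \<Rightarrow> bool" where
  "antichain le A \<longleftrightarrow> (\<forall>a\<in>A. \<forall>b\<in>A. (a, b) \<in> le \<longrightarrow> a = b)"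

definition maximals :: "'a rel \<Rightarrow> 'a set \<Rightarrow> 'a set" where
  "maximals le I = {m \<in> I. \<forall>a\<in>I. (m, a) \<in> le \<longrightarrow> a = m}"

definition consistent_downset :: "'a set \<Rightarrow> 'a rel \<Rightarrow> 'a rel \<Rightarrow> 'a set \<Rightarrow> bool" where
  "consistent_downset P le inc I \<longleftrightarrow> downset P le I \<and> consistent inc I"


section \<open>Simplicial complexes and their colourings\<close>

text \<open>
  A simplicial complex is given by its set of faces. The empty set is a face (of dimension
  \<open>-1\<close>); every vertex is a singleton face, so the vertex set is the union of the faces.
\<close>

definition simplicial_vertices :: "'v set set \<Rightarrow> 'v set" where
  "simplicial_vertices \<Delta> = \<Union>\<Delta>"

definition simplicial_colouring :: "nat \<Rightarrow> 'v set set \<Rightarrow> ('v \<Rightarrow> nat) \<Rightarrow> bool" where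
  "simplicial_colouring r \<Delta> \<kappa> \<longleftrightarrow>
     \<kappa> \<in> simplicial_vertices \<Delta> \<rightarrow> {1..r} \<and>
     (\<forall>u v. u \<noteq> v \<and> {u, v} \<in> \<Delta> \<longrightarrow> \<kappa> u \<noteq> \<kappa> v)"

definition simplicial_colourable :: "nat \<Rightarrow> 'v set set \<Rightarrow> bool" where
  "simplicial_colourable r \<Delta> \<longleftrightarrow> (\<exists>\<kappa>. simplicial_colouring r \<Delta> \<kappa>)"

definition simplicial_dim :: "'v set set \<Rightarrow> int" where
  "simplicial_dim \<Delta> = Max ((\<lambda>A. int (card A) - 1) ` \<Delta>)"

definition simplicial_balanced :: "'v set set \<Rightarrow> bool" where
  "simplicial_balanced \<Delta> \<longleftrightarrow>
     (\<exists>d::nat. simplicial_dim \<Delta> = int d - 1 \<and> simplicial_colourable d \<Delta>)"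

definition crossing_complex :: "'a set \<Rightarrow> 'a rel \<Rightarrow> 'a rel \<Rightarrow> 'a set set" where
  "crossing_complex P le inc = {A. A \<subseteq> P \<and> antichain le A \<and> consistent inc A}"


section \<open>Cubical complexes and their colourings\<close>

text \<open>
  A cubical complex is given by the set of its (nonempty) faces, each identified with its
  vertex set. Every vertex is a singleton face, and a face of dimension \<open>d\<close> has \<open>2 ^ d\<close>
  vertices, so that its dimension can be read off from its cardinality.
\<close>

definition cubical_vertices :: "'v set set \<Rightarrow> 'v set" where
  "cubical_vertices Q = \<Union>Q"

definition cubical_dim :: "'v set set \<Rightarrow> nat" where
  "cubical_dim Q = Max {d. \<exists>F\<in>Q. card F = 2 ^ d}"

text \<open>
  The vertices of \<open>[0,1]\<^sup>r\<close> are the 0-1 vectors indexed by \<open>{1..r}\<close>. A face of the cube is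
  a product of factors \<open>{0}\<close>, \<open>{1}\<close> and \<open>[0,1]\<close>, one for each coordinate; in terms of
  vertices, the last factor is \<open>{0, 1}\<close>.
\<close>

definition cube_vertices :: "nat \<Rightarrow> (nat \<Rightarrow> nat) set" where
  "cube_vertices r = {1..r} \<rightarrow>\<^sub>E {0, 1}"

definition cube_faces :: "nat \<Rightarrow> (nat \<Rightarrow> nat) set set" where
  "cube_faces r = {PiE {1..r} S | S. \<forall>i\<in>{1..r}. S i \<in> {{0}, {1}, {0, 1}}}"

definition cubical_colouring :: "nat \<Rightarrow> 'v set set \<Rightarrow> ('v \<Rightarrow> nat \<Rightarrow> nat) \<Rightarrow> bool" where
  "cubical_colouring r Q \<kappa> \<longleftrightarrow>
     \<kappa> \<in> cubical_vertices Q \<rightarrow> cube_vertices r \<and>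
     (\<forall>F\<in>Q. \<exists>G\<in>cube_faces r. bij_betw \<kappa> F G)"

definition cubical_colourable :: "nat \<Rightarrow> 'v set set \<Rightarrow> bool" where
  "cubical_colourable r Q \<longleftrightarrow> (\<exists>\<kappa>. cubical_colouring r Q \<kappa>)"

definition cubical_balanced :: "'v set set \<Rightarrow> bool" where
  "cubical_balanced Q \<longleftrightarrow> cubical_colourable (cubical_dim Q) Q"

definition pip_face :: "'a set \<Rightarrow> 'a set \<Rightarrow> 'a set set" where
  "pip_face I M = {I - N | N. N \<subseteq> M}"

definition pip_cubical_complex :: "'a set \<Rightarrow> 'a rel \<Rightarrow> 'a rel \<Rightarrow> 'a set set set" where
  "pip_cubical_complex P le inc =
     {pip_face I M | I M. consistent_downset P le inc I \<and> M \<subseteq> maximals le I}"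


section \<open>Agreement with the combinatorial data\<close>

context pip
begin

lemma crossing_complex_vertices: "simplicial_vertices (crossing_complex P le inc) = P"
proof -
  have "{p} \<in> crossing_complex P le inc" if "p \<in> P" for p
    using that inc_irrefl
    by (auto simp: crossing_complex_def antichain_def consistent_def irrefl_def)
  then show ?thesis
    by (auto simp: simplicial_vertices_def crossing_complex_def)
qed

lemma crossing_complex_mono:
  "\<lbrakk>A \<in> crossing_complex P le inc; B \<subseteq> A\<rbrakk> \<Longrightarrow> B \<in> crossing_complex P le inc"
  unfolding crossing_complex_def antichain_def consistent_def by blast

lemma consistent_downset_diff:
  assumes "consistent_downset P le inc I" "N \<subseteq> maximals le I"
  shows "consistent_downset P le inc (I - N)"
proof -
  have "a \<in> I - N" if "b \<in> I - N" "(a, b) \<in> le" for a b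
    using assms that unfolding consistent_downset_def downset_def maximals_def by blast
  then show ?thesis
    using assms unfolding consistent_downset_def downset_def consistent_def by blast
qed

lemma cubical_complex_vertices:
  "cubical_vertices (pip_cubical_complex P le inc) = {I. consistent_downset P le inc I}"
proof (intro equalityI subsetI)
  fix J assume "J \<in> cubical_vertices (pip_cubical_complex P le inc)"
  then obtain I M N where "consistent_downset P le inc I" "M \<subseteq> maximals le I" "N \<subseteq> M" "J = I - N"
    by (auto simp: cubical_vertices_def pip_cubical_complex_def pip_face_def)
  then show "J \<in> {I. consistent_downset P le inc I}"
    using consistent_downset_diff by auto
next
  fix I assume "I \<in> {I. consistent_downset P le inc I}"
  moreover have "I \<in> pip_face I {}" by (auto simp: pip_face_def)
  ultimately show "I \<in> cubical_vertices (pip_cubical_complex P le inc)"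
    by (auto simp: cubical_vertices_def pip_cubical_complex_def)
qed

lemma card_pip_face:
  assumes "consistent_downset P le inc I" "M \<subseteq> maximals le I"
  shows "card (pip_face I M) = 2 ^ card M"
proof -
  have sub: "M \<subseteq> I" using assms(2) by (auto simp: maximals_def)
  have "finite I"
    using assms(1) finite_carrier finite_subset
    by (auto simp: consistent_downset_def downset_def)
  then have fin: "finite M" using sub finite_subset by blast
  have eq: "pip_face I M = (\<lambda>N. I - N) ` Pow M" by (auto simp: pip_face_def)
  have inj: "inj_on (\<lambda>N. I - N) (Pow M)" using sub by (intro inj_onI) blast
  show ?thesis using fin by (simp add: eq card_image[OF inj] card_Pow)
qed

lemma cubical_dim_eq:
  "cubical_dim (pip_cubical_complex P le inc) =
     Max {card M | I M. consistent_downset P le inc I \<and> M \<subseteq> maximals le I}"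
proof -
  have "(\<exists>F\<in>pip_cubical_complex P le inc. card F = 2 ^ d) \<longleftrightarrow>
        (\<exists>I M. d = card M \<and> consistent_downset P le inc I \<and> M \<subseteq> maximals le I)"
    (is "?L \<longleftrightarrow> ?R") for d
  proof
    assume ?L
    then obtain I M where IM: "consistent_downset P le inc I" "M \<subseteq> maximals le I"
      and "card (pip_face I M) = 2 ^ d"
      unfolding pip_cubical_complex_def by blast
    then have "(2::nat) ^ card M = 2 ^ d" using card_pip_face by simp
    then have "d = card M" by simp
    with IM show ?R by blast
  next
    assume ?R
    then obtain I M where IM: "consistent_downset P le inc I" "M \<subseteq> maximals le I"
      and d: "d = card M" by blast
    have "pip_face I M \<in> pip_cubical_complex P le inc"
      using IM unfolding pip_cubical_complex_def by blast
    then show ?L using card_pip_face[OF IM] d by blast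
  qed
  then show ?thesis by (simp add: cubical_dim_def)
qed

end

end

theory Submission
  imports Defs
begin

text \<open>
  A colouring of the crossing complex yields the cubical colouring that sends a consistent
  downset to the vector of parities of its colour classes: removing a set of maximal elements,
  whose colours are pairwise distinct, flips precisely the coordinates of these colours.

  Conversely, a cubical colouring maps the edge joining \<open>I\<close> to \<open>I - {p}\<close> to an edge of the cube,
  in some direction. Opposite edges of a square have the same direction and adjacent ones do
  not. Removing the other maximal elements of \<open>I\<close> one at a time, one sees that the direction
  depends on \<open>p\<close> only, being that of the principal downset of \<open>p\<close>; this is the colour of \<open>p\<close>.
\<close>

section \<open>Consistent downsets and their maximal elements\<close>

definition down_closure :: "'a rel \<Rightarrow> 'a set \<Rightarrow> 'a set" where
  "down_closure le A = {x. \<exists>a\<in>A. (x, a) \<in> le}"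

context pip
begin

lemma le_refl: "p \<in> P \<Longrightarrow> (p, p) \<in> le"
  using partial_order by (auto simp: partial_order_on_def preorder_on_def refl_on_def)

lemma le_trans: "\<lbrakk>(a, b) \<in> le; (b, c) \<in> le\<rbrakk> \<Longrightarrow> (a, c) \<in> le"
  using partial_order unfolding partial_order_on_def preorder_on_def by (meson transD)

lemma le_antisym: "\<lbrakk>(a, b) \<in> le; (b, a) \<in> le\<rbrakk> \<Longrightarrow> a = b"
  using partial_order unfolding partial_order_on_def by (meson antisymD)

lemma le_carrier: "(a, b) \<in> le \<Longrightarrow> a \<in> P \<and> b \<in> P"
  using partial_order by (auto simp: partial_order_on_def preorder_on_def)

lemma consistent_downset_subset: "consistent_downset P le inc I \<Longrightarrow> I \<subseteq> P"
  by (simp add: consistent_downset_def downset_def)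

lemma finite_consistent_downset: "consistent_downset P le inc I \<Longrightarrow> finite I"
  using consistent_downset_subset finite_carrier finite_subset by blast

lemma consistent_downset_down_closure:
  assumes "A \<in> crossing_complex P le inc"
  shows "consistent_downset P le inc (down_closure le A)"
proof -
  have "downset P le (down_closure le A)"
    using le_carrier le_trans unfolding downset_def down_closure_def by blast
  moreover have "consistent inc (down_closure le A)"
    using assms inc_inherit
    unfolding consistent_def down_closure_def crossing_complex_def by blast
  ultimately show ?thesis by (simp add: consistent_downset_def)
qed

text \<open>If \<open>x\<close> in the closure lies above \<open>a\<close>, it also lies below some
  \<open>b\<close> in \<open>A\<close>. Then \<open>a = b\<close>, as \<open>A\<close> is an
  antichain, and antisymmetry gives \<open>x = a\<close>.\<close>

lemma subset_maximals_down_closure: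
  assumes "A \<in> crossing_complex P le inc"
  shows "A \<subseteq> maximals le (down_closure le A)"
proof
  fix a assume a: "a \<in> A"
  have A: "A \<subseteq> P" "antichain le A" using assms by (auto simp: crossing_complex_def)
  have "x = a" if "b \<in> A" "(x, b) \<in> le" "(a, x) \<in> le" for x b
    using A(2) a that le_trans le_antisym unfolding antichain_def by metis
  then show "a \<in> maximals le (down_closure le A)"
    using a A(1) le_refl unfolding maximals_def down_closure_def by blast
qed

text \<open>The link between the two complexes: the sets \<open>M\<close> that span cubes are the
  faces of the crossing complex. The witness \<open>I\<close> for a face is its down
  closure.\<close>

lemma crossing_complex_iff:
  "A \<in> crossing_complex P le inc \<longleftrightarrow>
     (\<exists>I. consistent_downset P le inc I \<and> A \<subseteq> maximals le I)"
proof
  assume "A \<in> crossing_complex P le inc"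
  then show "\<exists>I. consistent_downset P le inc I \<and> A \<subseteq> maximals le I"
    using consistent_downset_down_closure subset_maximals_down_closure by blast
next
  assume "\<exists>I. consistent_downset P le inc I \<and> A \<subseteq> maximals le I"
  then obtain I where I: "consistent_downset P le inc I" "A \<subseteq> maximals le I" by blast
  then have "A \<subseteq> I" by (auto simp: maximals_def)
  then have "A \<subseteq> P" "consistent inc A"
    using I(1) unfolding consistent_downset_def downset_def consistent_def by blast+
  moreover have "antichain le A"
    using I(2) \<open>A \<subseteq> I\<close> by (fastforce simp: antichain_def maximals_def)
  ultimately show "A \<in> crossing_complex P le inc"
    by (simp add: crossing_complex_def)
qed

lemma simplicial_dim_crossing_complex:
  "simplicial_dim (crossing_complex P le inc) =
     int (cubical_dim (pip_cubical_complex P le inc)) - 1"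
proof -
  let ?\<Delta> = "crossing_complex P le inc"
  have fin: "finite ?\<Delta>"
    using finite_carrier by (auto simp: crossing_complex_def)
  have ne: "?\<Delta> \<noteq> {}"
    by (auto simp: crossing_complex_def antichain_def consistent_def)
  have "{card M | I M. consistent_downset P le inc I \<and> M \<subseteq> maximals le I} = card ` ?\<Delta>"
    using crossing_complex_iff by blast
  moreover have "int (Max (card ` ?\<Delta>)) - 1 = Max ((\<lambda>n. int n - 1) ` card ` ?\<Delta>)"
    by (rule mono_Max_commute) (use fin ne in \<open>auto simp: mono_def\<close>)
  ultimately show ?thesis
    by (simp add: simplicial_dim_def cubical_dim_eq image_image)
qed

lemma maximal_above:
  assumes "finite I" "I \<subseteq> P" "x \<in> I"
  shows "\<exists>m\<in>maximals le I. (x, m) \<in> le"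
  using assms
proof (induction "card {y \<in> I. (x, y) \<in> le}" arbitrary: x rule: less_induct)
  case less
  show ?case
  proof (cases "x \<in> maximals le I")
    case True
    then show ?thesis using less.prems le_refl by blast
  next
    case False
    then obtain y where y: "y \<in> I" "(x, y) \<in> le" "y \<noteq> x"
      using less.prems by (auto simp: maximals_def)
    have "{z \<in> I. (y, z) \<in> le} \<subseteq> {z \<in> I. (x, z) \<in> le}" using y le_trans by blast
    moreover have "x \<notin> {z \<in> I. (y, z) \<in> le}" "x \<in> {z \<in> I. (x, z) \<in> le}"
      using y le_antisym le_refl less.prems by blast+
    ultimately have "{z \<in> I. (y, z) \<in> le} \<subset> {z \<in> I. (x, z) \<in> le}" by blast
    then have "card {z \<in> I. (y, z) \<in> le} < card {z \<in> I. (x, z) \<in> le}"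
      using less.prems(1) by (intro psubset_card_mono) auto
    then obtain m where "m \<in> maximals le I" "(y, m) \<in> le"
      using less.hyps less.prems y by blast
    then show ?thesis using y le_trans by blast
  qed
qed

text \<open>Every element of a finite downset lies below some maximal one, hence here below
  \<open>p\<close>. This ends the induction in \<open>direction_principal\<close>.\<close>

lemma unique_maximal_imp_principal:
  assumes "consistent_downset P le inc I" "maximals le I = {p}"
  shows "I = down_closure le {p}"
proof -
  have "p \<in> I" using assms(2) by (auto simp: maximals_def)
  moreover have "(x, p) \<in> le" if "x \<in> I" for x
    using maximal_above[OF finite_consistent_downset consistent_downset_subset that] assms
    by auto
  ultimately show ?thesis
    using assms(1) by (auto simp: down_closure_def consistent_downset_def downset_def)
qed

end

section \<open>Parities of colour classes as a cubical colouring\<close>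

definition class_parity :: "nat \<Rightarrow> ('a \<Rightarrow> nat) \<Rightarrow> 'a set \<Rightarrow> nat \<Rightarrow> nat" where
  "class_parity r \<kappa> I = (\<lambda>i\<in>{1..r}. card {p \<in> I. \<kappa> p = i} mod 2)"

lemma class_parity_in_cube_vertices: "class_parity r \<kappa> I \<in> cube_vertices r"
  by (auto simp: class_parity_def cube_vertices_def)

text \<open>As \<open>\<kappa>\<close> is injective on \<open>N\<close>, each colour class loses at
  most one element, and it loses one precisely when its colour occurs on \<open>N\<close>.\<close>

lemma class_parity_diff:
  assumes "finite I" "N \<subseteq> I" "inj_on \<kappa> N" "i \<in> {1..r}"
  shows "class_parity r \<kappa> (I - N) i =
    (if i \<in> \<kappa> ` N then 1 - class_parity r \<kappa> I i else class_parity r \<kappa> I i)"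
proof (cases "i \<in> \<kappa> ` N")
  case True
  then obtain p where p: "p \<in> N" "\<kappa> p = i" by blast
  have "{q \<in> I. \<kappa> q = i} = insert p {q \<in> I - N. \<kappa> q = i}"
    using p assms(2,3) by (auto dest: inj_onD)
  then have "card {q \<in> I. \<kappa> q = i} = Suc (card {q \<in> I - N. \<kappa> q = i})"
    using p assms(1) by simp
  then show ?thesis using True assms(4) by (simp add: class_parity_def) presburger
next
  case False
  then have "{q \<in> I - N. \<kappa> q = i} = {q \<in> I. \<kappa> q = i}" by auto
  then show ?thesis using False assms(4) by (simp add: class_parity_def)
qed

text \<open>Subsets of \<open>M\<close> correspond to sets of colours of \<open>M\<close>, that is,
  of coordinates to be flipped. So the image of the face is the subcube through the vector of
  \<open>I\<close> in these directions.\<close>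

lemma class_parity_bij_betw_face:
  assumes "finite I" "M \<subseteq> I" "inj_on \<kappa> M" "\<kappa> ` M \<subseteq> {1..r}"
  shows "\<exists>G\<in>cube_faces r. bij_betw (class_parity r \<kappa>) (pip_face I M) G"
proof -
  let ?c = "class_parity r \<kappa>"
  define S where "S i = (if i \<in> \<kappa> ` M then {0, 1} else {?c I i})" for i
  have c01: "?c I i \<in> {0, 1}" if "i \<in> {1..r}" for I i
    using class_parity_in_cube_vertices[of r \<kappa> I] that by (auto simp: cube_vertices_def)
  have diff: "?c (I - N) i = (if i \<in> \<kappa> ` N then 1 - ?c I i else ?c I i)"
    if "N \<subseteq> M" "i \<in> {1..r}" for N i
    using class_parity_diff[OF assms(1) _ inj_on_subset[OF assms(3)] that(2)] that(1) assms(2)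
    by auto
  have "S i \<in> {{0}, {1}, {0, 1}}" if "i \<in> {1..r}" for i
    using c01[OF that, of I] by (auto simp: S_def)
  then have "PiE {1..r} S \<in> cube_faces r"
    unfolding cube_faces_def by blast
  moreover have "bij_betw ?c (pip_face I M) (PiE {1..r} S)"
    unfolding bij_betw_def
  proof (intro conjI equalityI)
    have "N = N'" if N: "N \<subseteq> M" "N' \<subseteq> M" and eq: "?c (I - N) = ?c (I - N')" for N N'
    proof -
      have "p \<in> N \<longleftrightarrow> p \<in> N'" if p: "p \<in> M" for p
      proof -
        have "\<kappa> p \<in> {1..r}" using p assms(4) by auto
        \<comment> \<open>A 0-1 value differs from its flip, so this coordinate of the image shows
          whether the colour of \<open>p\<close> occurs on the removed set.\<close>
        then have "\<kappa> p \<in> \<kappa> ` N \<longleftrightarrow> \<kappa> p \<in> \<kappa> ` N'"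
          using diff[OF N(1), of "\<kappa> p"] diff[OF N(2), of "\<kappa> p"] eq c01[of "\<kappa> p" I]
          by (auto split: if_splits)
        then show ?thesis
          using p N inj_on_image_mem_iff[OF assms(3) p] by blast
      qed
      then show ?thesis using N by blast
    qed
    then show "inj_on ?c (pip_face I M)"
      by (auto simp: inj_on_def pip_face_def)
  next
    show "?c ` pip_face I M \<subseteq> PiE {1..r} S"
    proof
      fix v assume "v \<in> ?c ` pip_face I M"
      then obtain N where N: "N \<subseteq> M" "v = ?c (I - N)" by (auto simp: pip_face_def)
      have "v i \<in> S i" if "i \<in> {1..r}" for i
        using c01[of i "I - N"] diff[OF N(1) that] that N by (auto simp: S_def)
      then show "v \<in> PiE {1..r} S"
        using N by (auto simp: PiE_iff class_parity_def)
    qed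
  next
    show "PiE {1..r} S \<subseteq> ?c ` pip_face I M"
    proof
      fix g assume g: "g \<in> PiE {1..r} S"
      \<comment> \<open>The elements of \<open>M\<close> whose coordinate must be flipped to turn
        the vector of \<open>I\<close> into \<open>g\<close>.\<close>
      define N where "N = {p \<in> M. g (\<kappa> p) \<noteq> ?c I (\<kappa> p)}"
      have N: "N \<subseteq> M" by (auto simp: N_def)
      have "?c (I - N) i = g i" for i
      proof (cases "i \<in> {1..r}")
        case True
        have "g i \<in> S i" using g True by (auto simp: PiE_iff)
        moreover have "i \<in> \<kappa> ` N \<longleftrightarrow> i \<in> \<kappa> ` M \<and> g i \<noteq> ?c I i" by (auto simp: N_def)
        ultimately show ?thesis
          using diff[OF N True] c01[OF True, of I] by (auto simp: S_def split: if_splits)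
      next
        case False
        then show ?thesis using g by (auto simp: class_parity_def PiE_iff extensional_def)
      qed
      then have "g = ?c (I - N)" by auto
      then show "g \<in> ?c ` pip_face I M" using N by (auto simp: pip_face_def)
    qed
  qed
  ultimately show ?thesis by blast
qed

lemma (in pip) simplicial_imp_cubical_colouring:
  assumes "simplicial_colouring r (crossing_complex P le inc) \<kappa>"
  shows "cubical_colouring r (pip_cubical_complex P le inc) (class_parity r \<kappa>)"
  unfolding cubical_colouring_def
proof (intro conjI ballI)
  show "class_parity r \<kappa> \<in> cubical_vertices (pip_cubical_complex P le inc) \<rightarrow> cube_vertices r"
    by (simp add: class_parity_in_cube_vertices)
next
  fix F assume "F \<in> pip_cubical_complex P le inc"
  then obtain I M where F: "F = pip_face I M"
    and I: "consistent_downset P le inc I" and M: "M \<subseteq> maximals le I"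
    by (auto simp: pip_cubical_complex_def)
  have range: "\<kappa> p \<in> {1..r}" if "p \<in> P" for p
    using assms that crossing_complex_vertices by (auto simp: simplicial_colouring_def)
  have MI: "M \<subseteq> I" using M by (auto simp: maximals_def)
  have "M \<in> crossing_complex P le inc" using I M crossing_complex_iff by blast
  then have "{u, v} \<in> crossing_complex P le inc" if "u \<in> M" "v \<in> M" for u v
    by (rule crossing_complex_mono) (use that in auto)
  then have "inj_on \<kappa> M"
    using assms unfolding simplicial_colouring_def inj_on_def by blast
  moreover have "\<kappa> ` M \<subseteq> {1..r}"
    using range MI consistent_downset_subset[OF I] by blast
  ultimately show "\<exists>G\<in>cube_faces r. bij_betw (class_parity r \<kappa>) F G"
    using class_parity_bij_betw_face[OF finite_consistent_downset[OF I] MI] F by simp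
qed

section \<open>Edges and squares of the cube\<close>

definition flip_coord :: "nat \<Rightarrow> (nat \<Rightarrow> nat) \<Rightarrow> nat \<Rightarrow> nat" where
  "flip_coord i f = f(i := 1 - f i)"

text \<open>A face of the cube is a product, so replacing one coordinate of \<open>f\<close> by that
  of \<open>g\<close> stays in the face. Where \<open>f\<close> and \<open>g\<close> differ, the
  result is not \<open>f\<close>, so in a two-point face it is \<open>g\<close>.\<close>

lemma cube_edge:
  assumes "{f, g} \<in> cube_faces r" "f \<noteq> g"
  shows "\<exists>i\<in>{1..r}. g = flip_coord i f"
proof -
  obtain S where S: "{f, g} = PiE {1..r} S" "\<forall>i\<in>{1..r}. S i \<in> {{0}, {1}, {0, 1}}"
    using assms(1) by (auto simp: cube_faces_def)
  have fg: "f \<in> PiE {1..r} S" "g \<in> PiE {1..r} S" using S(1) by blast+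
  obtain i where i: "f i \<noteq> g i" using assms(2) by blast
  have ir: "i \<in> {1..r}" using i fg by (metis PiE_arb)
  have "f(i := g i) \<in> PiE {1..r} S" using fg ir by (auto simp: PiE_iff extensional_def)
  then have "f(i := g i) \<in> {f, g}" using S(1) by simp
  then have g: "g = f(i := g i)" using i by (metis fun_upd_same insertE singletonD)
  have "f i \<in> S i" "g i \<in> S i" using fg ir by (auto simp: PiE_iff)
  then have "g i = 1 - f i" using S(2) ir i by fastforce
  then show ?thesis using g ir by (metis flip_coord_def)
qed

text \<open>Two paths lead from \<open>f\<close> to the opposite corner. If \<open>i'\<close> were
  not \<open>i\<close>, the path through \<open>flip_coord j f\<close> would leave coordinate
  \<open>i\<close> unchanged, so the other path would flip it twice and return to \<open>f\<close>,
  against \<open>nf\<close>.\<close>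

lemma cube_square:
  assumes f: "f \<in> cube_vertices r" and ij: "i \<in> {1..r}" "j \<in> {1..r}"
    and ne: "flip_coord i f \<noteq> flip_coord j f"
    and eq: "flip_coord j' (flip_coord i f) = flip_coord i' (flip_coord j f)"
    and nf: "flip_coord j' (flip_coord i f) \<noteq> f"
  shows "i' = i"
proof (rule ccontr)
  assume ii: "i' \<noteq> i"
  have ij': "i \<noteq> j" using ne by blast
  have fi: "f i \<in> {0, 1}" using f ij(1) unfolding cube_vertices_def by (rule PiE_mem)
  have "j' = i" using fun_cong[OF eq, of i] ii ij' fi
    by (auto simp: flip_coord_def split: if_splits)
  then have "flip_coord j' (flip_coord i f) = f" using fi by (auto simp: flip_coord_def)
  then show False using nf by simp
qed

section \<open>Directions of edges as a simplicial colouring\<close>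

locale coloured_cubical_pip = pip P le inc
  for P :: "'a set" and le inc :: "'a rel" +
  fixes r :: nat and \<kappa> :: "'a set \<Rightarrow> nat \<Rightarrow> nat"
  assumes colouring: "cubical_colouring r (pip_cubical_complex P le inc) \<kappa>"
begin

text \<open>For \<open>p\<close> maximal in \<open>I\<close> the choice is unambiguous, since the
  two 0-1 vectors then differ in exactly one coordinate.\<close>

definition direction :: "'a set \<Rightarrow> 'a \<Rightarrow> nat" where
  "direction I p = (SOME i. i \<in> {1..r} \<and> \<kappa> (I - {p}) = flip_coord i (\<kappa> I))"

lemma colour_in_cube_vertices: "consistent_downset P le inc I \<Longrightarrow> \<kappa> I \<in> cube_vertices r"
  using colouring cubical_complex_vertices unfolding cubical_colouring_def by blast

lemma bij_betw_pip_face: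
  assumes "consistent_downset P le inc I" "M \<subseteq> maximals le I"
  shows "\<exists>G\<in>cube_faces r. bij_betw \<kappa> (pip_face I M) G"
  using assms colouring unfolding cubical_colouring_def pip_cubical_complex_def by blast

lemma direction:
  assumes "consistent_downset P le inc I" "p \<in> maximals le I"
  shows "direction I p \<in> {1..r} \<and> \<kappa> (I - {p}) = flip_coord (direction I p) (\<kappa> I)"
proof -
  have F: "pip_face I {p} = {I, I - {p}}" by (auto simp: pip_face_def subset_singleton_iff)
  obtain G where G: "G \<in> cube_faces r" "bij_betw \<kappa> (pip_face I {p}) G"
    using bij_betw_pip_face[OF assms(1), of "{p}"] assms(2) by auto
  have "I \<noteq> I - {p}" using assms(2) by (auto simp: maximals_def)
  then have "{\<kappa> I, \<kappa> (I - {p})} \<in> cube_faces r" "\<kappa> I \<noteq> \<kappa> (I - {p})"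
    using G F by (auto simp: bij_betw_def inj_on_def)
  from someI_ex[OF cube_edge[OF this, unfolded Bex_def]] show ?thesis
    unfolding direction_def .
qed

text \<open>\<open>\<kappa>\<close> is injective on the square spanned by \<open>p\<close> and
  \<open>q\<close>. Equal directions would give \<open>I - {p}\<close> and \<open>I - {q}\<close>
  the same colour, and the distinct colours at the ends of both diagonals are what
  \<open>cube_square\<close> requires.\<close>

lemma direction_square:
  assumes I: "consistent_downset P le inc I" and pq: "p \<in> maximals le I" "q \<in> maximals le I"
    and "p \<noteq> q"
  shows "direction I p \<noteq> direction I q" "direction (I - {q}) p = direction I p"
proof -
  have pqI: "p \<in> I" "q \<in> I" using pq by (auto simp: maximals_def)
  have inj: "inj_on \<kappa> (pip_face I {p, q})"
    using bij_betw_pip_face[OF I, of "{p, q}"] pq bij_betw_def by auto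
  have face: "I \<in> pip_face I {p, q}" "I - {p} \<in> pip_face I {p, q}"
    "I - {q} \<in> pip_face I {p, q}" "I - {p, q} \<in> pip_face I {p, q}"
    unfolding pip_face_def by blast+
  have ne: "\<kappa> (I - {p}) \<noteq> \<kappa> (I - {q})"
    using inj_on_eq_iff[OF inj face(2,3)] pqI \<open>p \<noteq> q\<close> by blast
  have nf: "\<kappa> (I - {p, q}) \<noteq> \<kappa> I"
    using inj_on_eq_iff[OF inj face(4,1)] pqI by blast
  have Ip: "consistent_downset P le inc (I - {p})" and Iq: "consistent_downset P le inc (I - {q})"
    using consistent_downset_diff[OF I] pq by simp_all
  have max: "q \<in> maximals le (I - {p})" "p \<in> maximals le (I - {q})"
    using pq \<open>p \<noteq> q\<close> by (auto simp: maximals_def)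
  have two: "I - {p} - {q} = I - {p, q}" "I - {q} - {p} = I - {p, q}" by auto
  note d = direction[OF I pq(1)] direction[OF I pq(2)]
    direction[OF Ip max(1), unfolded two] direction[OF Iq max(2), unfolded two]
  show "direction I p \<noteq> direction I q" using d ne by auto
  show "direction (I - {q}) p = direction I p"
    \<comment> \<open>Here \<open>i\<close> and \<open>i'\<close> are the directions of the two
      edges that remove \<open>p\<close>, and \<open>j\<close> and \<open>j'\<close> those of the
      two that remove \<open>q\<close>.\<close>
    by (rule cube_square[OF colour_in_cube_vertices[OF I], where j = "direction I q"
          and j' = "direction (I - {p}) q"])
      (use d ne nf in auto)
qed

text \<open>Removing a maximal \<open>q\<close> other than \<open>p\<close> keeps \<open>p\<close>
  maximal and passes to the opposite edge of a square. Once \<open>p\<close> is the only maximal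
  element, \<open>I\<close> is principal.\<close>

lemma direction_principal:
  assumes "consistent_downset P le inc I" "p \<in> maximals le I"
  shows "direction I p = direction (down_closure le {p}) p"
  using assms
proof (induction "card I" arbitrary: I rule: less_induct)
  case less
  show ?case
  proof (cases "maximals le I = {p}")
    case True
    then show ?thesis using unique_maximal_imp_principal less.prems(1) by simp
  next
    case False
    then obtain q where q: "q \<in> maximals le I" "q \<noteq> p" using less.prems(2) by blast
    have "q \<in> I" using q by (auto simp: maximals_def)
    then have "card (I - {q}) < card I"
      using finite_consistent_downset[OF less.prems(1)] by (intro psubset_card_mono) auto
    moreover have "consistent_downset P le inc (I - {q})"
      using consistent_downset_diff[OF less.prems(1)] q by simp
    moreover have "p \<in> maximals le (I - {q})"
      using q less.prems(2) by (auto simp: maximals_def)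
    ultimately show ?thesis
      using less.hyps direction_square(2)[OF less.prems q(1)] q(2) by metis
  qed
qed

text \<open>The ends of an edge \<open>{u, v}\<close> are maximal in the downset that they generate,
  where their directions differ. By \<open>direction_principal\<close> these directions are the
  colours of \<open>u\<close> and \<open>v\<close>.\<close>

lemma simplicial_colouring_direction:
  "simplicial_colouring r (crossing_complex P le inc) (\<lambda>p. direction (down_closure le {p}) p)"
  unfolding simplicial_colouring_def crossing_complex_vertices
proof (intro conjI allI impI funcsetI)
  fix p assume "p \<in> P"
  then have "{p} \<in> crossing_complex P le inc"
    using inc_irrefl by (auto simp: crossing_complex_def antichain_def consistent_def irrefl_def)
  then show "direction (down_closure le {p}) p \<in> {1..r}"
    using direction consistent_downset_down_closure subset_maximals_down_closure by blast
next
  fix u v assume uv: "u \<noteq> v \<and> {u, v} \<in> crossing_complex P le inc"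
  let ?I = "down_closure le {u, v}"
  have I: "consistent_downset P le inc ?I" using uv consistent_downset_down_closure by blast
  have "u \<in> maximals le ?I" "v \<in> maximals le ?I" using uv subset_maximals_down_closure by blast+
  then show "direction (down_closure le {u}) u \<noteq> direction (down_closure le {v}) v"
    using direction_square(1)[OF I] direction_principal[OF I] uv by metis
qed

end

theorem theorem7p3:
  fixes P :: "'a set" and le inc :: "'a rel"
  assumes "pip P le inc"
  shows "(\<forall>r::nat. simplicial_colourable r (crossing_complex P le inc) \<longleftrightarrow>
                   cubical_colourable r (pip_cubical_complex P le inc)) \<and>
         (simplicial_balanced (crossing_complex P le inc) \<longleftrightarrow>
          cubical_balanced (pip_cubical_complex P le inc))"
proof -
  interpret pip P le inc by (fact assms)
  have colourable: "simplicial_colourable r (crossing_complex P le inc) \<longleftrightarrow>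
      cubical_colourable r (pip_cubical_complex P le inc)" for r
  proof
    assume "simplicial_colourable r (crossing_complex P le inc)"
    then show "cubical_colourable r (pip_cubical_complex P le inc)"
      using simplicial_imp_cubical_colouring
      unfolding simplicial_colourable_def cubical_colourable_def by blast
  next
    assume "cubical_colourable r (pip_cubical_complex P le inc)"
    then obtain \<kappa> where "cubical_colouring r (pip_cubical_complex P le inc) \<kappa>"
      by (auto simp: cubical_colourable_def)
    then interpret coloured_cubical_pip P le inc r \<kappa> by unfold_locales
    show "simplicial_colourable r (crossing_complex P le inc)"
      using simplicial_colouring_direction unfolding simplicial_colourable_def by blast
  qed
  \<comment> \<open>The dimension formula forces the \<open>d\<close> in
    \<open>simplicial_balanced\<close> to be the dimension of the cubical complex, so both sides ask
    for the same number of colours.\<close>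
  then show ?thesis
    by (simp add: simplicial_balanced_def cubical_balanced_def simplicial_dim_crossing_complex)
qed

end
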